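(* Let $\mathbb K$ be an algebraically closed field of characteristic $0$ and let $V$ be a finite-dimensional vector space over $\mathbb K$. The free Lie-Yamaguti algebra $\mathcal L(V)$ over $V$ is rigid.
   Context: A Lie-Yamaguti algebra $(L,[\,,],\{\,,,\})$ over a commutative ring $k$ is a $k$-module $L$ with a $k$-bilinear map $[\,,]:L\times L\to L$ and a $k$-trilinear map $\{\,,,\}:L\times L\times L\to L$ such that for all $x,y,z,u,v,w\in L$ (with $\sum_{\circlearrowleft(x,y,z)}$ the sum over cyclic permutations of $x,y,z$): (LY1) $[x,y]=-[y,x]$; (LY2) $\{x,y,z\}=-\{y,x,z\}$; (LY3) $\sum_{\circlearrowleft(x,y,z)}([[x,y],z]+\{x,y,z\})=0$; (LY4) $\sum_{\circlearrowleft(x,y,z)}\{[x,y],z,u\}=0$; (LY5) $\{x,y,[u,v]\}=[\{x,y,u\},v]+[u,\{x,y,v\}]$; (LY6) $\{x,y,\{u,v,w\}\}=\{\{x,y,u\},v,w\}+\{u,\{x,y,v\},w\}+\{u,v,\{x,y,w\}\}$. A morphism of Lie-Yamaguti algebras is a linear map preserving both operations. Free objects. A Lie-Yamaguti algebra $L_0$ over $\mathbb K$ with a set map $i:B\to L_0$ is free over the set $B$ if for any Lie-Yamaguti algebra $L$ over $\mathbb K$ and any set map $f:B\to L$ there is a unique Lie-Yamaguti algebra morphism $\widetilde f:L_0\to L$ with $\widetilde f\circ i=f$. For a finite set $B$ it exists and is unique up to isomorphism, and is denoted $\mathcal L(B)$. For a finite-dimensional vector space $V$ with basis a finite set $B$,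 $\mathcal L(V):=\mathcal L(B)$. Deformations and rigidity. Let $L$ be a Lie-Yamaguti algebra over $\mathbb K$, let $K=\mathbb K[[t]]$ and let $L[[t]]:=L\otimes_{\mathbb K}K$, a $K$-module; (multi)linear maps on $L$ are extended $K$-(multi)linearly to $L[[t]]$. A one-parameter formal deformation of $L$ is a triple $(L[[t]],F_t,G_t)$ with $F_t:L[[t]]\times L[[t]]\to L[[t]]$ a $K$-bilinear map and $G_t:L[[t]]\times L[[t]]\times L[[t]]\to L[[t]]$ a $K$-trilinear map of the forms $F_t=\sum_{i\ge0}F_it^i$, $G_t=\sum_{i\ge0}G_it^i$, with $F_i:L\times L\to L$ $\mathbb K$-bilinear and $G_i:L\times L\times L\to L$ $\mathbb K$-trilinear (extended over $K$), $F_0=[\,,]$, $G_0=\{\,,,\}$, such that $(L[[t]],F_t,G_t)$ is a Lie-Yamaguti algebra over $K$. Two deformations $(F_t,G_t)$, $(F'_t,G'_t)$ are equivalent if there is a $K$-linear automorphism $\Phi_t$ of $L[[t]]$ of the form $\Phi_t(a)=a+\sum_{i\ge1}\phi_i(a)t^i$ ($a\in L$), with each $\phi_i:L\to L$ $\mathbb K$-linear (extended over $K$), such that $\Phi_t(F_t(a,b))=F'_t(\Phi_t(a),\Phi_t(b))$ and $\Phi_t(G_t(a,b,c))=G'_t(\Phi_t(a),\Phi_t(b),\Phi_t(c))$ for all $a,b,c\in L$. The identity deformation is the one with $F_i=0=G_i$ for all $i\ge1$; a deformation is trivial if it is equivalent to the identity deformation. $L$ is rigid if every one-parameter formal deformation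 of $L$ is trivial.
   Formalization: L[[t]] is taken to be all formal power series with coefficients in L (the t-adic completion of L⊗K[[t]]); with the uncompleted tensor product the claim is false for dim V ≥ 2, where the infinite-dimensional L(V) has non-trivial deformations. *)

theory Defs
  imports "HOL-Computational_Algebra.Computational_Algebra" "HOL-Library.FuncSet"
begin

section \<open>Multilinear maps and Lie-Yamaguti algebras\<close>

text \<open>
  The underlying module of an algebra is a submodule \<open>L\<close> of a module given by a type and a
  scalar multiplication; operations are only constrained on \<open>L\<close>.
\<close>

definition linear_on ::
    "('k::comm_ring_1 \<Rightarrow> 'a::ab_group_add \<Rightarrow> 'a) \<Rightarrow> 'a set \<Rightarrow>
     ('k \<Rightarrow> 'c::ab_group_add \<Rightarrow> 'c) \<Rightarrow> 'c set \<Rightarrow> ('a \<Rightarrow> 'c) \<Rightarrow> bool" where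
  "linear_on scale L scale' M f \<longleftrightarrow>
     f \<in> L \<rightarrow> M \<and>
     (\<forall>x\<in>L. \<forall>y\<in>L. f (x + y) = f x + f y) \<and>
     (\<forall>c. \<forall>x\<in>L. f (scale c x) = scale' c (f x))"

definition bilinear_on ::
    "('k::comm_ring_1 \<Rightarrow> 'a::ab_group_add \<Rightarrow> 'a) \<Rightarrow> 'a set \<Rightarrow> ('a \<Rightarrow> 'a \<Rightarrow> 'a) \<Rightarrow> bool" where
  "bilinear_on scale L f \<longleftrightarrow>
     (\<forall>y\<in>L. linear_on scale L scale L (\<lambda>x. f x y)) \<and>
     (\<forall>x\<in>L. linear_on scale L scale L (\<lambda>y. f x y))"

definition trilinear_on ::
    "('k::comm_ring_1 \<Rightarrow> 'a::ab_group_add \<Rightarrow> 'a) \<Rightarrow> 'a set \<Rightarrow> ('a \<Rightarrow> 'a \<Rightarrow> 'a \<Rightarrow> 'a) \<Rightarrow> bool" where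
  "trilinear_on scale L g \<longleftrightarrow>
     (\<forall>y\<in>L. \<forall>z\<in>L. linear_on scale L scale L (\<lambda>x. g x y z)) \<and>
     (\<forall>x\<in>L. \<forall>z\<in>L. linear_on scale L scale L (\<lambda>y. g x y z)) \<and>
     (\<forall>x\<in>L. \<forall>y\<in>L. linear_on scale L scale L (\<lambda>z. g x y z))"

locale ly_algebra = module scale
  for scale :: "'k::comm_ring_1 \<Rightarrow> 'a::ab_group_add \<Rightarrow> 'a" +
  fixes L :: "'a set"
    and br :: "'a \<Rightarrow> 'a \<Rightarrow> 'a"
    and tr :: "'a \<Rightarrow> 'a \<Rightarrow> 'a \<Rightarrow> 'a"
  assumes submodule: "subspace L"
    and bilinear: "bilinear_on scale L br"
    and trilinear: "trilinear_on scale L tr"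
    and LY1: "\<lbrakk>x \<in> L; y \<in> L\<rbrakk> \<Longrightarrow> br x y = - br y x"
    and LY2: "\<lbrakk>x \<in> L; y \<in> L; z \<in> L\<rbrakk> \<Longrightarrow> tr x y z = - tr y x z"
    and LY3: "\<lbrakk>x \<in> L; y \<in> L; z \<in> L\<rbrakk> \<Longrightarrow>
        (br (br x y) z + tr x y z) + (br (br y z) x + tr y z x) + (br (br z x) y + tr z x y) = 0"
    and LY4: "\<lbrakk>x \<in> L; y \<in> L; z \<in> L; u \<in> L\<rbrakk> \<Longrightarrow>
        tr (br x y) z u + tr (br y z) x u + tr (br z x) y u = 0"
    and LY5: "\<lbrakk>x \<in> L; y \<in> L; u \<in> L; v \<in> L\<rbrakk> \<Longrightarrow>
        tr x y (br u v) = br (tr x y u) v + br u (tr x y v)"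
    and LY6: "\<lbrakk>x \<in> L; y \<in> L; u \<in> L; v \<in> L; w \<in> L\<rbrakk> \<Longrightarrow>
        tr x y (tr u v w) = tr (tr x y u) v w + tr u (tr x y v) w + tr u v (tr x y w)"

definition ly_hom ::
    "('k::comm_ring_1 \<Rightarrow> 'a::ab_group_add \<Rightarrow> 'a) \<Rightarrow> 'a set \<Rightarrow> ('a \<Rightarrow> 'a \<Rightarrow> 'a) \<Rightarrow>
     ('a \<Rightarrow> 'a \<Rightarrow> 'a \<Rightarrow> 'a) \<Rightarrow>
     ('k \<Rightarrow> 'c::ab_group_add \<Rightarrow> 'c) \<Rightarrow> 'c set \<Rightarrow> ('c \<Rightarrow> 'c \<Rightarrow> 'c) \<Rightarrow>
     ('c \<Rightarrow> 'c \<Rightarrow> 'c \<Rightarrow> 'c) \<Rightarrow> ('a \<Rightarrow> 'c) \<Rightarrow> bool" where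
  "ly_hom scale L br tr scale' M br' tr' h \<longleftrightarrow>
     linear_on scale L scale' M h \<and>
     (\<forall>x\<in>L. \<forall>y\<in>L. h (br x y) = br' (h x) (h y)) \<and>
     (\<forall>x\<in>L. \<forall>y\<in>L. \<forall>z\<in>L. h (tr x y z) = tr' (h x) (h y) (h z))"

text \<open>
  The universal property, tested against all algebras whose module lives on the type \<open>'c\<close>.
  HOL cannot quantify over types inside a formula, so \<open>'c\<close> is a parameter.
\<close>

definition is_free_ly ::
    "'c::ab_group_add itself \<Rightarrow> ('k::comm_ring_1 \<Rightarrow> 'a::ab_group_add \<Rightarrow> 'a) \<Rightarrow> 'a set \<Rightarrow>
     ('a \<Rightarrow> 'a \<Rightarrow> 'a) \<Rightarrow> ('a \<Rightarrow> 'a \<Rightarrow> 'a \<Rightarrow> 'a) \<Rightarrow> 'b set \<Rightarrow> ('b \<Rightarrow> 'a) \<Rightarrow> bool" where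
  "is_free_ly _ scale L br tr B i \<longleftrightarrow>
     ly_algebra scale L br tr \<and> i \<in> B \<rightarrow> L \<and>
     (\<forall>(scale' :: 'k \<Rightarrow> 'c \<Rightarrow> 'c) M br' tr' f.
        ly_algebra scale' M br' tr' \<and> f \<in> B \<rightarrow> M \<longrightarrow>
        (\<exists>h. ly_hom scale L br tr scale' M br' tr' h \<and> (\<forall>b\<in>B. h (i b) = f b) \<and>
          (\<forall>h'. ly_hom scale L br tr scale' M br' tr' h' \<and> (\<forall>b\<in>B. h' (i b) = f b)
                 \<longrightarrow> (\<forall>x\<in>L. h' x = h x))))"


section \<open>The free Lie-Yamaguti algebra\<close>

text \<open>
  The free algebra is built as formal expressions modulo the congruence generated by the axioms
  of a module with a bilinear and a trilinear operation satisfying the Lie-Yamaguti identities.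
\<close>

datatype (ly_gens: 'b, dead 'k) ly_term =
    Gen 'b
  | Zero
  | Add "('b, 'k) ly_term" "('b, 'k) ly_term"
  | Neg "('b, 'k) ly_term"
  | Scale 'k "('b, 'k) ly_term"
  | Br "('b, 'k) ly_term" "('b, 'k) ly_term"
  | Tr "('b, 'k) ly_term" "('b, 'k) ly_term" "('b, 'k) ly_term"

inductive ly_eq :: "('b, 'k::comm_ring_1) ly_term \<Rightarrow> ('b, 'k) ly_term \<Rightarrow> bool" where
  refl: "ly_eq s s"
| sym: "ly_eq s t \<Longrightarrow> ly_eq t s"
| trans: "ly_eq s t \<Longrightarrow> ly_eq t u \<Longrightarrow> ly_eq s u"
| cong_Add: "ly_eq s s' \<Longrightarrow> ly_eq t t' \<Longrightarrow> ly_eq (Add s t) (Add s' t')"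
| cong_Neg: "ly_eq s s' \<Longrightarrow> ly_eq (Neg s) (Neg s')"
| cong_Scale: "ly_eq s s' \<Longrightarrow> ly_eq (Scale c s) (Scale c s')"
| cong_Br: "ly_eq s s' \<Longrightarrow> ly_eq t t' \<Longrightarrow> ly_eq (Br s t) (Br s' t')"
| cong_Tr: "ly_eq s s' \<Longrightarrow> ly_eq t t' \<Longrightarrow> ly_eq u u' \<Longrightarrow> ly_eq (Tr s t u) (Tr s' t' u')"
| add_assoc: "ly_eq (Add (Add s t) u) (Add s (Add t u))"
| add_comm: "ly_eq (Add s t) (Add t s)"
| add_zero: "ly_eq (Add Zero s) s"
| add_neg: "ly_eq (Add (Neg s) s) Zero"
| scale_add: "ly_eq (Scale c (Add s t)) (Add (Scale c s) (Scale c t))"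
| add_scale: "ly_eq (Scale (c + d) s) (Add (Scale c s) (Scale d s))"
| scale_scale: "ly_eq (Scale c (Scale d s)) (Scale (c * d) s)"
| scale_one: "ly_eq (Scale 1 s) s"
| br_add1: "ly_eq (Br (Add s s') t) (Add (Br s t) (Br s' t))"
| br_add2: "ly_eq (Br s (Add t t')) (Add (Br s t) (Br s t'))"
| br_scale1: "ly_eq (Br (Scale c s) t) (Scale c (Br s t))"
| br_scale2: "ly_eq (Br s (Scale c t)) (Scale c (Br s t))"
| tr_add1: "ly_eq (Tr (Add s s') t u) (Add (Tr s t u) (Tr s' t u))"
| tr_add2: "ly_eq (Tr s (Add t t') u) (Add (Tr s t u) (Tr s t' u))"
| tr_add3: "ly_eq (Tr s t (Add u u')) (Add (Tr s t u) (Tr s t u'))"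
| tr_scale1: "ly_eq (Tr (Scale c s) t u) (Scale c (Tr s t u))"
| tr_scale2: "ly_eq (Tr s (Scale c t) u) (Scale c (Tr s t u))"
| tr_scale3: "ly_eq (Tr s t (Scale c u)) (Scale c (Tr s t u))"
| ly1: "ly_eq (Br x y) (Neg (Br y x))"
| ly2: "ly_eq (Tr x y z) (Neg (Tr y x z))"
| ly3: "ly_eq (Add (Add (Add (Br (Br x y) z) (Tr x y z)) (Add (Br (Br y z) x) (Tr y z x)))
                   (Add (Br (Br z x) y) (Tr z x y))) Zero"
| ly4: "ly_eq (Add (Add (Tr (Br x y) z u) (Tr (Br y z) x u)) (Tr (Br z x) y u)) Zero"
| ly5: "ly_eq (Tr x y (Br u v)) (Add (Br (Tr x y u) v) (Br u (Tr x y v)))"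
| ly6: "ly_eq (Tr x y (Tr u v w))
              (Add (Add (Tr (Tr x y u) v w) (Tr u (Tr x y v) w)) (Tr u v (Tr x y w)))"

quotient_type (overloaded) ('b, 'k) free_ly = "('b, 'k::comm_ring_1) ly_term" / ly_eq
  morphisms rep_free_ly abs_free_ly
  by (rule equivpI; blast intro: reflpI sympI transpI ly_eq.refl ly_eq.sym ly_eq.trans)

instantiation free_ly :: (type, comm_ring_1) ab_group_add
begin

lift_definition zero_free_ly :: "('a, 'b) free_ly" is Zero .
lift_definition plus_free_ly :: "('a, 'b) free_ly \<Rightarrow> ('a, 'b) free_ly \<Rightarrow> ('a, 'b) free_ly"
  is Add by (rule ly_eq.cong_Add)
lift_definition uminus_free_ly :: "('a, 'b) free_ly \<Rightarrow> ('a, 'b) free_ly"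
  is Neg by (rule ly_eq.cong_Neg)
definition minus_free_ly :: "('a, 'b) free_ly \<Rightarrow> ('a, 'b) free_ly \<Rightarrow> ('a, 'b) free_ly" where
  "minus_free_ly x y = x + - y"

instance
proof
  fix a b c :: "('a, 'b) free_ly"
  show "a + b + c = a + (b + c)" by transfer (rule ly_eq.add_assoc)
  show "a + b = b + a" by transfer (rule ly_eq.add_comm)
  show "0 + a = a" by transfer (rule ly_eq.add_zero)
  show "- a + a = 0" by transfer (rule ly_eq.add_neg)
  show "a - b = a + - b" by (rule minus_free_ly_def)
qed

end

lift_definition free_gen :: "'b \<Rightarrow> ('b, 'k::comm_ring_1) free_ly" is Gen .
lift_definition free_scale :: "'k::comm_ring_1 \<Rightarrow> ('b, 'k) free_ly \<Rightarrow> ('b, 'k) free_ly"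
  is Scale by (rule ly_eq.cong_Scale)
lift_definition free_br ::
    "('b, 'k::comm_ring_1) free_ly \<Rightarrow> ('b, 'k) free_ly \<Rightarrow> ('b, 'k) free_ly"
  is Br by (rule ly_eq.cong_Br)
lift_definition free_tr ::
    "('b, 'k::comm_ring_1) free_ly \<Rightarrow> ('b, 'k) free_ly \<Rightarrow> ('b, 'k) free_ly \<Rightarrow> ('b, 'k) free_ly"
  is Tr by (rule ly_eq.cong_Tr)

text \<open>
  Elements represented by expressions in the generators from \<open>B\<close>. Taking a set rather than a
  type of generators allows \<open>B\<close> to be empty.
\<close>

definition free_ly_over :: "'b set \<Rightarrow> ('b, 'k::comm_ring_1) free_ly set" where
  "free_ly_over B = abs_free_ly ` {t. ly_gens t \<subseteq> B}"

lemma free_scale_module: "module (free_scale :: 'k::comm_ring_1 \<Rightarrow> ('b, 'k) free_ly \<Rightarrow> _)"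
proof
  fix a b :: 'k and x y :: "('b, 'k) free_ly"
  show "free_scale a (x + y) = free_scale a x + free_scale a y"
    by transfer (rule ly_eq.scale_add)
  show "free_scale (a + b) x = free_scale a x + free_scale b x"
    by transfer (rule ly_eq.add_scale)
  show "free_scale a (free_scale b x) = free_scale (a * b) x"
    by transfer (rule ly_eq.scale_scale)
  show "free_scale 1 x = x"
    by transfer (rule ly_eq.scale_one)
qed

lemma abs_free_ly_in_over: "ly_gens t \<subseteq> B \<Longrightarrow> abs_free_ly t \<in> free_ly_over B"
  by (auto simp: free_ly_over_def)

lemma free_ly_overE:
  assumes "x \<in> free_ly_over B"
  obtains t where "x = abs_free_ly t" "ly_gens t \<subseteq> B"
  using assms by (auto simp: free_ly_over_def)

lemma free_ly_over_closed:
  "b \<in> B \<Longrightarrow> free_gen b \<in> free_ly_over B"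
  "0 \<in> free_ly_over B"
  "\<lbrakk>x \<in> free_ly_over B; y \<in> free_ly_over B\<rbrakk> \<Longrightarrow> x + y \<in> free_ly_over B"
  "x \<in> free_ly_over B \<Longrightarrow> - x \<in> free_ly_over B"
  "x \<in> free_ly_over B \<Longrightarrow> free_scale c x \<in> free_ly_over B"
  "\<lbrakk>x \<in> free_ly_over B; y \<in> free_ly_over B\<rbrakk> \<Longrightarrow> free_br x y \<in> free_ly_over B"
  "\<lbrakk>x \<in> free_ly_over B; y \<in> free_ly_over B; z \<in> free_ly_over B\<rbrakk> \<Longrightarrow> free_tr x y z \<in> free_ly_over B"
  by (auto elim!: free_ly_overE intro!: abs_free_ly_in_over
      simp: subset_eq free_gen.abs_eq zero_free_ly.abs_eq plus_free_ly.abs_eq uminus_free_ly.abs_eq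
        free_scale.abs_eq free_br.abs_eq free_tr.abs_eq)

lemma free_ly_over_induct [consumes 1, case_names gen zero add neg scale br tr]:
  fixes P :: "('b, 'k::comm_ring_1) free_ly \<Rightarrow> bool"
  assumes "x \<in> free_ly_over B"
    and "\<And>b. b \<in> B \<Longrightarrow> P (free_gen b)"
    and "P 0"
    and "\<And>x y. \<lbrakk>x \<in> free_ly_over B; y \<in> free_ly_over B; P x; P y\<rbrakk> \<Longrightarrow> P (x + y)"
    and "\<And>x. \<lbrakk>x \<in> free_ly_over B; P x\<rbrakk> \<Longrightarrow> P (- x)"
    and "\<And>c x. \<lbrakk>x \<in> free_ly_over B; P x\<rbrakk> \<Longrightarrow> P (free_scale c x)"
    and "\<And>x y. \<lbrakk>x \<in> free_ly_over B; y \<in> free_ly_over B; P x; P y\<rbrakk> \<Longrightarrow> P (free_br x y)"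
    and "\<And>x y z. \<lbrakk>x \<in> free_ly_over B; y \<in> free_ly_over B; z \<in> free_ly_over B; P x; P y; P z\<rbrakk>
           \<Longrightarrow> P (free_tr x y z)"
  shows "P x"
proof -
  have mem: "abs_free_ly t \<in> free_ly_over B" if "ly_gens t \<subseteq> B" for t :: "('b, 'k) ly_term"
    using that by (auto simp: free_ly_over_def)
  have "P (abs_free_ly t)" if "ly_gens t \<subseteq> B" for t :: "('b, 'k) ly_term"
    using that
  proof (induction t)
    case (Gen b)
    then show ?case using assms(2)[of b] by (simp add: free_gen.abs_eq)
  next
    case Zero
    then show ?case using assms(3) by (simp add: zero_free_ly.abs_eq)
  next
    case (Add s t)
    then show ?case
      using assms(4)[of "abs_free_ly s" "abs_free_ly t"] mem by (simp add: plus_free_ly.abs_eq)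
  next
    case (Neg s)
    then show ?case
      using assms(5)[of "abs_free_ly s"] mem by (simp add: uminus_free_ly.abs_eq)
  next
    case (Scale c s)
    then show ?case
      using assms(6)[of "abs_free_ly s" c] mem by (simp add: free_scale.abs_eq)
  next
    case (Br s t)
    then show ?case
      using assms(7)[of "abs_free_ly s" "abs_free_ly t"] mem by (simp add: free_br.abs_eq)
  next
    case (Tr s t u)
    then show ?case
      using assms(8)[of "abs_free_ly s" "abs_free_ly t" "abs_free_ly u"] mem
      by (simp add: free_tr.abs_eq)
  qed
  then show ?thesis using assms(1) by (auto simp: free_ly_over_def)
qed

lemma free_ly_algebra:
  fixes B :: "'b set"
  shows "ly_algebra free_scale (free_ly_over B :: ('b, 'k::comm_ring_1) free_ly set)
           free_br free_tr"
proof -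
  interpret module "free_scale :: 'k \<Rightarrow> ('b, 'k) free_ly \<Rightarrow> _" by (rule free_scale_module)
  note c = free_ly_over_closed
  show ?thesis
  proof
    show "subspace (free_ly_over B)"
      by (rule subspaceI) (auto intro: c)
    have br:
      "free_br (x + x') y = free_br x y + free_br x' y"
      "free_br x (y + y') = free_br x y + free_br x y'"
      "free_br (free_scale a x) y = free_scale a (free_br x y)"
      "free_br x (free_scale a y) = free_scale a (free_br x y)"
      for a :: 'k and x x' y y' :: "('b, 'k) free_ly"
      by (transfer, rule ly_eq.br_add1) (transfer, rule ly_eq.br_add2,
          transfer, rule ly_eq.br_scale1, transfer, rule ly_eq.br_scale2)
    have tr:
      "free_tr (x + x') y z = free_tr x y z + free_tr x' y z"
      "free_tr x (y + y') z = free_tr x y z + free_tr x y' z"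
      "free_tr x y (z + z') = free_tr x y z + free_tr x y z'"
      "free_tr (free_scale a x) y z = free_scale a (free_tr x y z)"
      "free_tr x (free_scale a y) z = free_scale a (free_tr x y z)"
      "free_tr x y (free_scale a z) = free_scale a (free_tr x y z)"
      for a :: 'k and x x' y y' z z' :: "('b, 'k) free_ly"
      by (transfer, rule ly_eq.tr_add1) (transfer, rule ly_eq.tr_add2,
          transfer, rule ly_eq.tr_add3, transfer, rule ly_eq.tr_scale1,
          transfer, rule ly_eq.tr_scale2, transfer, rule ly_eq.tr_scale3)
    show "bilinear_on (free_scale :: 'k \<Rightarrow> ('b, 'k) free_ly \<Rightarrow> _) (free_ly_over B) free_br"
      by (auto simp: bilinear_on_def linear_on_def br intro: c)
    show "trilinear_on (free_scale :: 'k \<Rightarrow> ('b, 'k) free_ly \<Rightarrow> _) (free_ly_over B) free_tr"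
      by (auto simp: trilinear_on_def linear_on_def tr intro: c)
  next
    fix x y z u v w :: "('b, 'k) free_ly"
    show "free_br x y = - free_br y x" by transfer (rule ly_eq.ly1)
    show "free_tr x y z = - free_tr y x z" by transfer (rule ly_eq.ly2)
    show "(free_br (free_br x y) z + free_tr x y z) + (free_br (free_br y z) x + free_tr y z x)
        + (free_br (free_br z x) y + free_tr z x y) = 0"
      by transfer (rule ly_eq.ly3)
    show "free_tr (free_br x y) z u + free_tr (free_br y z) x u + free_tr (free_br z x) y u = 0"
      by transfer (rule ly_eq.ly4)
    show "free_tr x y (free_br u v) = free_br (free_tr x y u) v + free_br u (free_tr x y v)"
      by transfer (rule ly_eq.ly5)
    show "free_tr x y (free_tr u v w) =
        free_tr (free_tr x y u) v w + free_tr u (free_tr x y v) w + free_tr u v (free_tr x y w)"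
      by transfer (rule ly_eq.ly6)
  qed
qed

context ly_algebra
begin

lemma closed:
  "0 \<in> L"
  "\<lbrakk>x \<in> L; y \<in> L\<rbrakk> \<Longrightarrow> x + y \<in> L"
  "x \<in> L \<Longrightarrow> - x \<in> L"
  "x \<in> L \<Longrightarrow> scale c x \<in> L"
  "\<lbrakk>x \<in> L; y \<in> L\<rbrakk> \<Longrightarrow> br x y \<in> L"
  "\<lbrakk>x \<in> L; y \<in> L; z \<in> L\<rbrakk> \<Longrightarrow> tr x y z \<in> L"
  using submodule bilinear trilinear
  by (auto simp: subspace_0 subspace_add subspace_neg subspace_scale
      bilinear_on_def trilinear_on_def linear_on_def Pi_iff)

lemma br_linear:
  "\<lbrakk>x \<in> L; x' \<in> L; y \<in> L\<rbrakk> \<Longrightarrow> br (x + x') y = br x y + br x' y"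
  "\<lbrakk>x \<in> L; y \<in> L; y' \<in> L\<rbrakk> \<Longrightarrow> br x (y + y') = br x y + br x y'"
  "\<lbrakk>x \<in> L; y \<in> L\<rbrakk> \<Longrightarrow> br (scale c x) y = scale c (br x y)"
  "\<lbrakk>x \<in> L; y \<in> L\<rbrakk> \<Longrightarrow> br x (scale c y) = scale c (br x y)"
  using bilinear by (auto simp: bilinear_on_def linear_on_def)

lemma tr_linear:
  "\<lbrakk>x \<in> L; x' \<in> L; y \<in> L; z \<in> L\<rbrakk> \<Longrightarrow> tr (x + x') y z = tr x y z + tr x' y z"
  "\<lbrakk>x \<in> L; y \<in> L; y' \<in> L; z \<in> L\<rbrakk> \<Longrightarrow> tr x (y + y') z = tr x y z + tr x y' z"
  "\<lbrakk>x \<in> L; y \<in> L; z \<in> L; z' \<in> L\<rbrakk> \<Longrightarrow> tr x y (z + z') = tr x y z + tr x y z'"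
  "\<lbrakk>x \<in> L; y \<in> L; z \<in> L\<rbrakk> \<Longrightarrow> tr (scale c x) y z = scale c (tr x y z)"
  "\<lbrakk>x \<in> L; y \<in> L; z \<in> L\<rbrakk> \<Longrightarrow> tr x (scale c y) z = scale c (tr x y z)"
  "\<lbrakk>x \<in> L; y \<in> L; z \<in> L\<rbrakk> \<Longrightarrow> tr x y (scale c z) = scale c (tr x y z)"
  using trilinear by (auto simp: trilinear_on_def linear_on_def)

primrec ly_eval :: "('b \<Rightarrow> 'a) \<Rightarrow> ('b, 'k) ly_term \<Rightarrow> 'a" where
  "ly_eval f (Gen b) = f b"
| "ly_eval f Zero = 0"
| "ly_eval f (Add s t) = ly_eval f s + ly_eval f t"
| "ly_eval f (Neg s) = - ly_eval f s"
| "ly_eval f (Scale c s) = scale c (ly_eval f s)"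
| "ly_eval f (Br s t) = br (ly_eval f s) (ly_eval f t)"
| "ly_eval f (Tr s t u) = tr (ly_eval f s) (ly_eval f t) (ly_eval f u)"

lemma ly_eval_closed: "range f \<subseteq> L \<Longrightarrow> ly_eval f t \<in> L"
  by (induction t) (auto intro: closed)

lemma ly_eval_cong:
  assumes "ly_eq s t" "range f \<subseteq> L"
  shows "ly_eval f s = ly_eval f t"
  using assms(1)
proof induction
  case (ly1 x y)
  show ?case unfolding ly_eval.simps by (intro LY1 ly_eval_closed[OF assms(2)])
next
  case (ly2 x y z)
  show ?case unfolding ly_eval.simps by (intro LY2 ly_eval_closed[OF assms(2)])
next
  case (ly3 x y z)
  show ?case
    using LY3[of "ly_eval f x" "ly_eval f y" "ly_eval f z"] ly_eval_closed[OF assms(2)] by simp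
next
  case (ly4 x y z u)
  show ?case
    using LY4[of "ly_eval f x" "ly_eval f y" "ly_eval f z" "ly_eval f u"]
      ly_eval_closed[OF assms(2)] by simp
next
  case (ly5 x y u v)
  show ?case
    using LY5[of "ly_eval f x" "ly_eval f y" "ly_eval f u" "ly_eval f v"]
      ly_eval_closed[OF assms(2)] by simp
next
  case (ly6 x y u v w)
  show ?case
    using LY6[of "ly_eval f x" "ly_eval f y" "ly_eval f u" "ly_eval f v" "ly_eval f w"]
      ly_eval_closed[OF assms(2)] by simp
next
  case (add_comm s t)
  show ?case by (simp add: add.commute)
next
  case (add_assoc s t u)
  show ?case by (simp add: add.assoc)
qed (simp_all add: ly_eval_closed[OF assms(2)] br_linear tr_linear
       scale_right_distrib scale_left_distrib)

end

text \<open>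
  The type \<open>'c\<close> is arbitrary here, so \<open>free_ly_over B\<close> is free over \<open>B\<close> without restriction on
  the target algebras; hence it is the free algebra over \<open>B\<close> up to unique isomorphism.
\<close>

theorem free_ly_universal:
  fixes B :: "'b set"
  shows "is_free_ly TYPE('c::ab_group_add) free_scale
           (free_ly_over B :: ('b, 'k::comm_ring_1) free_ly set) free_br free_tr B free_gen"
  unfolding is_free_ly_def
proof (intro conjI allI impI)
  show "ly_algebra free_scale (free_ly_over B :: ('b, 'k) free_ly set) free_br free_tr"
    by (rule free_ly_algebra)
  show "free_gen \<in> B \<rightarrow> (free_ly_over B :: ('b, 'k) free_ly set)"
    by (auto intro: free_ly_over_closed)
next
  fix scale' :: "'k \<Rightarrow> 'c \<Rightarrow> 'c" and M br' tr' and f :: "'b \<Rightarrow> 'c"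
  assume "ly_algebra scale' M br' tr' \<and> f \<in> B \<rightarrow> M"
  then have M: "ly_algebra scale' M br' tr'" and f: "f \<in> B \<rightarrow> M" by auto
  interpret ly_algebra scale' M br' tr' by (rule M)
  let ?F = "free_ly_over B :: ('b, 'k) free_ly set"
  define g where "g b = (if b \<in> B then f b else 0)" for b
  have g: "range g \<subseteq> M" using f closed(1) by (auto simp: g_def)
  define h where "h x = ly_eval g (rep_free_ly x)" for x :: "('b, 'k) free_ly"
  have habs: "h (abs_free_ly t) = ly_eval g t" for t
    unfolding h_def
    by (rule ly_eval_cong[OF _ g]) (rule Quotient3_rep_abs[OF Quotient3_free_ly ly_eq.refl])
  have hom: "ly_hom free_scale ?F free_br free_tr scale' M br' tr' h"
  proof -
    have "h x \<in> M" for x by (simp add: h_def ly_eval_closed[OF g])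
    moreover have "h (x + y) = h x + h y" for x y
      by (induction x, induction y) (simp add: habs plus_free_ly.abs_eq)
    moreover have "h (free_scale c x) = scale' c (h x)" for c x
      by (induction x) (simp add: habs free_scale.abs_eq)
    moreover have "h (free_br x y) = br' (h x) (h y)" for x y
      by (induction x, induction y) (simp add: habs free_br.abs_eq)
    moreover have "h (free_tr x y z) = tr' (h x) (h y) (h z)" for x y z
      by (induction x, induction y, induction z) (simp add: habs free_tr.abs_eq)
    ultimately show ?thesis by (auto simp: ly_hom_def linear_on_def)
  qed
  have hgen: "h (free_gen b) = f b" if "b \<in> B" for b
    using that by (simp add: free_gen.abs_eq habs g_def)
  have uniq: "h' x = h x"
    if h': "ly_hom free_scale ?F free_br free_tr scale' M br' tr' h'"
       and gen: "\<forall>b\<in>B. h' (free_gen b) = f b" and x: "x \<in> ?F" for h' x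
  proof -
    have hom_zero: "k 0 = 0"
      if "ly_hom free_scale ?F free_br free_tr scale' M br' tr' k" for k
    proof -
      have "k (0 + 0) = k 0 + k 0"
        using that free_ly_over_closed(2) unfolding ly_hom_def linear_on_def by blast
      then show ?thesis by simp
    qed
    have hom_neg: "k (- u) = - k u"
      if k: "ly_hom free_scale ?F free_br free_tr scale' M br' tr' k" and u: "u \<in> ?F" for k u
    proof -
      have "k (- u + u) = k (- u) + k u"
        using k u free_ly_over_closed(4)[OF u] unfolding ly_hom_def linear_on_def by blast
      then show ?thesis using hom_zero[OF k] by (simp add: eq_neg_iff_add_eq_0)
    qed
    show ?thesis using x
    proof (induction x rule: free_ly_over_induct)
      case (gen b)
      then show ?case using that(2) hgen by simp
    next
      case zero
      show ?case using hom_zero[OF h'] hom_zero[OF hom] by simp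
    next
      case (add x y)
      then show ?case using h' hom by (simp add: ly_hom_def linear_on_def)
    next
      case (neg x)
      then show ?case using hom_neg[OF h'] hom_neg[OF hom] by simp
    next
      case (scale c x)
      then show ?case using h' hom by (simp add: ly_hom_def linear_on_def)
    next
      case (br x y)
      then show ?case using h' hom by (simp add: ly_hom_def)
    next
      case (tr x y z)
      then show ?case using h' hom by (simp add: ly_hom_def)
    qed
  qed
  show "\<exists>h. ly_hom free_scale ?F free_br free_tr scale' M br' tr' h \<and>
          (\<forall>b\<in>B. h (free_gen b) = f b) \<and>
          (\<forall>h'. ly_hom free_scale ?F free_br free_tr scale' M br' tr' h' \<and>
                 (\<forall>b\<in>B. h' (free_gen b) = f b) \<longrightarrow> (\<forall>x\<in>?F. h' x = h x))"
    using hom hgen uniq by blast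
qed


section \<open>Formal deformations and rigidity\<close>

text \<open>
  \<open>L[[t]]\<close> consists of the formal power series with coefficients in \<open>L\<close>, i.e. the \<open>t\<close>-adically
  complete tensor product of \<open>L\<close> with \<open>K[[t]]\<close>. For an infinite-dimensional \<open>L\<close> this is larger
  than the algebraic tensor product, in which the infinite sums
  \<open>\<Sum>i. F\<^sub>i(a, b) t\<^sup>i\<close> and \<open>\<Sum>i. \<phi>\<^sub>i(a) t\<^sup>i\<close> need not exist.
\<close>

definition fps_over :: "'a::zero set \<Rightarrow> 'a fps set" where
  "fps_over L = {a. \<forall>n. a $ n \<in> L}"

definition fps_scale ::
    "('k::comm_ring_1 \<Rightarrow> 'a::ab_group_add \<Rightarrow> 'a) \<Rightarrow> 'k fps \<Rightarrow> 'a fps \<Rightarrow> 'a fps" where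
  "fps_scale scale c a = Abs_fps (\<lambda>n. \<Sum>i\<le>n. scale (c $ i) (a $ (n - i)))"

text \<open>
  The \<open>K[[t]]\<close>-(multi)linear extensions of \<open>\<Sum>i. \<phi>\<^sub>i t\<^sup>i\<close>, \<open>\<Sum>i. F\<^sub>i t\<^sup>i\<close> and \<open>\<Sum>i. G\<^sub>i t\<^sup>i\<close>; for example
  the coefficient of \<open>t\<^sup>n\<close> in \<open>F\<^sub>t(a, b)\<close> is the sum of all \<open>F\<^sub>i(a\<^sub>p, b\<^sub>q)\<close> with \<open>i + p + q = n\<close>.
\<close>

definition fps_map1 :: "(nat \<Rightarrow> 'a \<Rightarrow> 'a) \<Rightarrow> 'a::ab_group_add fps \<Rightarrow> 'a fps" where
  "fps_map1 \<phi> a = Abs_fps (\<lambda>n. \<Sum>i\<le>n. \<phi> i (a $ (n - i)))"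

definition fps_map2 ::
    "(nat \<Rightarrow> 'a \<Rightarrow> 'a \<Rightarrow> 'a) \<Rightarrow> 'a::ab_group_add fps \<Rightarrow> 'a fps \<Rightarrow> 'a fps" where
  "fps_map2 F a b = Abs_fps (\<lambda>n. \<Sum>i\<le>n. \<Sum>p\<le>n - i. F i (a $ p) (b $ (n - i - p)))"

definition fps_map3 ::
    "(nat \<Rightarrow> 'a \<Rightarrow> 'a \<Rightarrow> 'a \<Rightarrow> 'a) \<Rightarrow> 'a::ab_group_add fps \<Rightarrow> 'a fps \<Rightarrow> 'a fps \<Rightarrow> 'a fps" where
  "fps_map3 G a b c =
     Abs_fps (\<lambda>n. \<Sum>i\<le>n. \<Sum>p\<le>n - i. \<Sum>q\<le>n - i - p.
       G i (a $ p) (b $ q) (c $ (n - i - p - q)))"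

text \<open>
  A deformation \<open>(F\<^sub>t, G\<^sub>t)\<close> is given by its coefficient families \<open>(F\<^sub>i)\<close>, \<open>(G\<^sub>i)\<close>, which it
  determines on \<open>L\<close>.
\<close>

definition formal_deformation ::
    "('k::comm_ring_1 \<Rightarrow> 'a::ab_group_add \<Rightarrow> 'a) \<Rightarrow> 'a set \<Rightarrow> ('a \<Rightarrow> 'a \<Rightarrow> 'a) \<Rightarrow>
     ('a \<Rightarrow> 'a \<Rightarrow> 'a \<Rightarrow> 'a) \<Rightarrow>
     (nat \<Rightarrow> 'a \<Rightarrow> 'a \<Rightarrow> 'a) \<Rightarrow> (nat \<Rightarrow> 'a \<Rightarrow> 'a \<Rightarrow> 'a \<Rightarrow> 'a) \<Rightarrow> bool" where
  "formal_deformation scale L br tr F G \<longleftrightarrow>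
     (\<forall>i. bilinear_on scale L (F i)) \<and>
     (\<forall>i. trilinear_on scale L (G i)) \<and>
     (\<forall>x\<in>L. \<forall>y\<in>L. F 0 x y = br x y) \<and>
     (\<forall>x\<in>L. \<forall>y\<in>L. \<forall>z\<in>L. G 0 x y z = tr x y z) \<and>
     ly_algebra (fps_scale scale) (fps_over L) (fps_map2 F) (fps_map3 G)"

definition equivalent_deformations ::
    "('k::comm_ring_1 \<Rightarrow> 'a::ab_group_add \<Rightarrow> 'a) \<Rightarrow> 'a set \<Rightarrow>
     (nat \<Rightarrow> 'a \<Rightarrow> 'a \<Rightarrow> 'a) \<Rightarrow> (nat \<Rightarrow> 'a \<Rightarrow> 'a \<Rightarrow> 'a \<Rightarrow> 'a) \<Rightarrow>
     (nat \<Rightarrow> 'a \<Rightarrow> 'a \<Rightarrow> 'a) \<Rightarrow> (nat \<Rightarrow> 'a \<Rightarrow> 'a \<Rightarrow> 'a \<Rightarrow> 'a) \<Rightarrow> bool" where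
  "equivalent_deformations scale L F G F' G' \<longleftrightarrow>
     (\<exists>\<phi>. (\<forall>i. linear_on scale L scale L (\<phi> i)) \<and>
          (\<forall>x\<in>L. \<phi> 0 x = x) \<and>
          linear_on (fps_scale scale) (fps_over L) (fps_scale scale) (fps_over L) (fps_map1 \<phi>) \<and>
          bij_betw (fps_map1 \<phi>) (fps_over L) (fps_over L) \<and>
          (\<forall>a\<in>L. \<forall>b\<in>L.
             fps_map1 \<phi> (fps_map2 F (fps_const a) (fps_const b)) =
             fps_map2 F' (fps_map1 \<phi> (fps_const a)) (fps_map1 \<phi> (fps_const b))) \<and>
          (\<forall>a\<in>L. \<forall>b\<in>L. \<forall>c\<in>L.
             fps_map1 \<phi> (fps_map3 G (fps_const a) (fps_const b) (fps_const c)) =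
             fps_map3 G' (fps_map1 \<phi> (fps_const a)) (fps_map1 \<phi> (fps_const b))
               (fps_map1 \<phi> (fps_const c))))"

definition trivial_deformation ::
    "('k::comm_ring_1 \<Rightarrow> 'a::ab_group_add \<Rightarrow> 'a) \<Rightarrow> 'a set \<Rightarrow> ('a \<Rightarrow> 'a \<Rightarrow> 'a) \<Rightarrow>
     ('a \<Rightarrow> 'a \<Rightarrow> 'a \<Rightarrow> 'a) \<Rightarrow>
     (nat \<Rightarrow> 'a \<Rightarrow> 'a \<Rightarrow> 'a) \<Rightarrow> (nat \<Rightarrow> 'a \<Rightarrow> 'a \<Rightarrow> 'a \<Rightarrow> 'a) \<Rightarrow> bool" where
  "trivial_deformation scale L br tr F G \<longleftrightarrow>
     equivalent_deformations scale L F G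
       (\<lambda>i. if i = 0 then br else (\<lambda>_ _. 0)) (\<lambda>i. if i = 0 then tr else (\<lambda>_ _ _. 0))"

definition ly_rigid ::
    "('k::comm_ring_1 \<Rightarrow> 'a::ab_group_add \<Rightarrow> 'a) \<Rightarrow> 'a set \<Rightarrow> ('a \<Rightarrow> 'a \<Rightarrow> 'a) \<Rightarrow>
     ('a \<Rightarrow> 'a \<Rightarrow> 'a \<Rightarrow> 'a) \<Rightarrow> bool" where
  "ly_rigid scale L br tr \<longleftrightarrow>
     (\<forall>F G. formal_deformation scale L br tr F G \<longrightarrow> trivial_deformation scale L br tr F G)"

end

theory Submission
  imports Defs
begin

text \<open>
  Why a free Lie-Yamaguti algebra \<open>L\<close> is rigid. Let \<open>(F\<^sub>t, G\<^sub>t)\<close> be a deformation. The deformed algebra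
  \<open>L[[t]]\<close> is in particular a Lie-Yamaguti algebra over the ground ring, so freeness produces a
  morphism \<open>h\<close> from \<open>L\<close> into it that sends every generator to itself, viewed as a constant series.
  Prescribing the generators is all it takes, so no cohomological obstruction has to be computed.

  Write \<open>h(x) = \<Sum>n. \<psi>\<^sub>n(x) t\<^sup>n\<close>. Reduction modulo \<open>t\<close> turns the deformed operations into the
  original ones, so \<open>\<psi>\<^sub>0\<close> is an endomorphism of \<open>L\<close> that fixes the generators; by the uniqueness part
  of freeness it is the identity. The extension \<open>\<Psi> = \<Sum>n. \<psi>\<^sub>n t\<^sup>n\<close> of \<open>h\<close> to \<open>L[[t]]\<close> therefore has leading
  coefficient the identity and is invertible, with inverse of the same form
  (\<open>inverse_family_left_inverse\<close>, \<open>inverse_family_right_inverse\<close>). Moreover \<open>\<Psi>\<close> takes the undeformed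
  operations on \<open>L[[t]]\<close> to the deformed ones: this holds on constant series because \<open>h\<close> is a
  morphism, and a \<open>K[[t]]\<close>-multilinear map on \<open>L[[t]]\<close> is determined by its values on constant series
  (\<open>fps_linear_eqI\<close> and its bilinear and trilinear versions). Hence \<open>\<Psi>\<close> inverse is an equivalence
  between the given deformation and the identity deformation.
\<close>

section \<open>Linear maps on power series with coefficients in a module\<close>

lemma sum_triangle_swap:
  fixes f :: "nat \<Rightarrow> nat \<Rightarrow> 'a::comm_monoid_add"
  shows "(\<Sum>i\<le>n. \<Sum>j\<le>n - i. f i j) = (\<Sum>j\<le>n. \<Sum>i\<le>n - j. f i j)"
proof -
  have "(\<Sum>i\<le>n. \<Sum>j\<le>n - i. f i j) = (\<Sum>i\<le>n. \<Sum>j | j \<le> n \<and> i + j \<le> n. f i j)"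
    by (intro sum.cong) auto
  also have "\<dots> = (\<Sum>j\<le>n. \<Sum>i | i \<le> n \<and> i + j \<le> n. f i j)"
    using sum.swap_restrict[of "{..n}" "{..n}" f "\<lambda>i j. i + j \<le> n"] by simp
  also have "\<dots> = (\<Sum>j\<le>n. \<Sum>i\<le>n - j. f i j)"
    by (intro sum.cong) auto
  finally show ?thesis .
qed

lemma linear_on_mem: "linear_on s L s' M f \<Longrightarrow> x \<in> L \<Longrightarrow> f x \<in> M"
  by (auto simp: linear_on_def)

lemma linear_on_comp:
  "linear_on s L s' M f \<Longrightarrow> linear_on s' M s'' N g \<Longrightarrow> linear_on s L s'' N (\<lambda>x. g (f x))"
  by (auto simp: linear_on_def Pi_iff)

locale coefficient_module = module scale
  for scale :: "'k::comm_ring_1 \<Rightarrow> 'a::ab_group_add \<Rightarrow> 'a" +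
  fixes L :: "'a set"
  assumes subspace_L: "subspace L"
begin

abbreviation fps_linear :: "('a fps \<Rightarrow> 'a fps) \<Rightarrow> bool" where
  "fps_linear \<equiv> linear_on (fps_scale scale) (fps_over L) (fps_scale scale) (fps_over L)"

lemma L_closed:
  "0 \<in> L" "x \<in> L \<Longrightarrow> y \<in> L \<Longrightarrow> x + y \<in> L" "x \<in> L \<Longrightarrow> - x \<in> L" "x \<in> L \<Longrightarrow> scale c x \<in> L"
  "(\<And>i. i \<in> I \<Longrightarrow> f i \<in> L) \<Longrightarrow> sum f I \<in> L"
  using subspace_L
  by (auto intro: subspace_0 subspace_add subspace_neg subspace_scale subspace_sum)

lemma fps_scale_nth: "fps_scale scale c a $ n = (\<Sum>i\<le>n. scale (c $ i) (a $ (n - i)))"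
  by (simp add: fps_scale_def)

lemma fps_scale_const_nth: "fps_scale scale (fps_const c) a $ n = scale c (a $ n)"
proof -
  have "fps_scale scale (fps_const c) a $ n = (\<Sum>i\<le>n. if i = 0 then scale c (a $ n) else 0)"
    unfolding fps_scale_nth by (intro sum.cong) auto
  then show ?thesis by simp
qed

lemma fps_scale_X_nth: "fps_scale scale fps_X a $ n = (if n = 0 then 0 else a $ (n - 1))"
proof -
  have "fps_scale scale fps_X a $ n = (\<Sum>i\<le>n. if i = 1 then a $ (n - 1) else 0)"
    unfolding fps_scale_nth by (intro sum.cong) auto
  then show ?thesis by simp
qed

lemma fps_over_const: "x \<in> L \<Longrightarrow> fps_const x \<in> fps_over L"
  using L_closed(1) by (simp add: fps_over_def)

lemma linear_on_zero: "linear_on s M scale L f \<Longrightarrow> 0 \<in> M \<Longrightarrow> f 0 = 0"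
  unfolding linear_on_def by (metis add.right_neutral add_left_cancel)

lemma linear_on_sum:
  assumes f: "linear_on scale L scale L f" and "finite I" and x: "\<And>i. i \<in> I \<Longrightarrow> x i \<in> L"
  shows "f (sum x I) = (\<Sum>i\<in>I. f (x i))"
  using \<open>finite I\<close> x
proof (induction I)
  case empty
  show ?case using linear_on_zero[OF f L_closed(1)] by simp
next
  case (insert i I)
  then show ?case using f L_closed(5)[of I x] by (simp add: linear_on_def)
qed

text \<open>
  Splitting off the constant term, \<open>a = a\<^sub>0 + t b\<close>, reduces coefficient \<open>n\<close> at \<open>a\<close> to coefficient
  \<open>n - 1\<close> at \<open>b\<close>. So a \<open>K[[t]]\<close>-linear map is automatically \<open>t\<close>-adically continuous, although constant
  series need not span \<open>L[[t]]\<close> when \<open>L\<close> is not finitely generated.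
\<close>

lemma fps_linear_eqI:
  assumes P: "fps_linear P" and Q: "fps_linear Q"
    and const: "\<And>x. x \<in> L \<Longrightarrow> P (fps_const x) = Q (fps_const x)"
    and a: "a \<in> fps_over L"
  shows "P a = Q a"
proof (rule fps_ext)
  fix n
  show "P a $ n = Q a $ n" using a
  proof (induction n arbitrary: a rule: less_induct)
    case (less n)
    let ?b = "fps_shift 1 a"
    have b: "?b \<in> fps_over L" and a0: "a $ 0 \<in> L" using less.prems by (auto simp: fps_over_def)
    have Xb: "fps_scale scale fps_X ?b \<in> fps_over L"
      using less.prems L_closed(1) by (auto simp: fps_over_def fps_scale_X_nth)
    have split: "a = fps_const (a $ 0) + fps_scale scale fps_X ?b"
      by (rule fps_ext) (simp add: fps_scale_X_nth)
    have "R a = R (fps_const (a $ 0)) + fps_scale scale fps_X (R ?b)" if "fps_linear R" for R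
    proof -
      have "R (fps_const (a $ 0) + fps_scale scale fps_X ?b) =
          R (fps_const (a $ 0)) + fps_scale scale fps_X (R ?b)"
        using that b Xb fps_over_const[OF a0] by (simp add: linear_on_def)
      then show ?thesis using split by simp
    qed
    \<comment> \<open>At \<open>n = 0\<close> the term with the factor \<open>t\<close> does not contribute, which settles the base case.\<close>
    from this[OF P] this[OF Q] show ?case
      using const[OF a0] less.IH[OF _ b] by (simp add: fps_scale_X_nth)
  qed
qed

text \<open>
  Both sides are linear in each argument separately, so the linear case can be applied to one
  argument at a time, the others being kept fixed.
\<close>

lemma bilinear_on_fps_eqI:
  assumes P: "bilinear_on (fps_scale scale) (fps_over L) P"
    and Q: "bilinear_on (fps_scale scale) (fps_over L) Q"
    and \<Psi>: "fps_linear \<Psi>"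
    and const: "\<And>x y. \<lbrakk>x \<in> L; y \<in> L\<rbrakk> \<Longrightarrow>
      \<Psi> (P (fps_const x) (fps_const y)) = Q (\<Psi> (fps_const x)) (\<Psi> (fps_const y))"
    and a: "a \<in> fps_over L" and b: "b \<in> fps_over L"
  shows "\<Psi> (P a b) = Q (\<Psi> a) (\<Psi> b)"
proof -
  note D = bilinear_on_def
  have mem: "\<Psi> c \<in> fps_over L" if "c \<in> fps_over L" for c
    using \<Psi> that by (auto simp: linear_on_def)
  have Q1: "fps_linear (\<lambda>c. Q (\<Psi> c) d)" and Q2: "fps_linear (\<lambda>c. Q d (\<Psi> c))"
    if "d \<in> fps_over L" for d
    using linear_on_comp[OF \<Psi>, of _ _ "\<lambda>c. Q c d"] linear_on_comp[OF \<Psi>, of _ _ "\<lambda>c. Q d c"]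
      Q that by (simp_all add: D)
  have P1: "fps_linear (\<lambda>c. \<Psi> (P c d))" and P2: "fps_linear (\<lambda>c. \<Psi> (P d c))"
    if "d \<in> fps_over L" for d
    using linear_on_comp[OF _ \<Psi>, of _ _ "\<lambda>c. P c d"] linear_on_comp[OF _ \<Psi>, of _ _ "\<lambda>c. P d c"]
      P that by (simp_all add: D)
  have "\<Psi> (P (fps_const x) b) = Q (\<Psi> (fps_const x)) (\<Psi> b)" if x: "x \<in> L" for x
    by (rule fps_linear_eqI[OF P2 Q2 _ b]) (use x const fps_over_const mem in auto)
  then show ?thesis
    by (intro fps_linear_eqI[OF P1 Q1 _ a]) (use b mem in auto)
qed

lemma trilinear_on_fps_eqI:
  assumes P: "trilinear_on (fps_scale scale) (fps_over L) P"
    and Q: "trilinear_on (fps_scale scale) (fps_over L) Q"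
    and \<Psi>: "fps_linear \<Psi>"
    and const: "\<And>x y z. \<lbrakk>x \<in> L; y \<in> L; z \<in> L\<rbrakk> \<Longrightarrow>
      \<Psi> (P (fps_const x) (fps_const y) (fps_const z)) =
      Q (\<Psi> (fps_const x)) (\<Psi> (fps_const y)) (\<Psi> (fps_const z))"
    and a: "a \<in> fps_over L" and b: "b \<in> fps_over L" and c: "c \<in> fps_over L"
  shows "\<Psi> (P a b c) = Q (\<Psi> a) (\<Psi> b) (\<Psi> c)"
proof -
  note D = trilinear_on_def
  have mem: "\<Psi> d \<in> fps_over L" if "d \<in> fps_over L" for d
    using \<Psi> that by (auto simp: linear_on_def)
  have P1: "fps_linear (\<lambda>u. \<Psi> (P u b c))"
    by (rule linear_on_comp[OF _ \<Psi>]) (use P b c in \<open>simp add: D\<close>)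
  have Q1: "fps_linear (\<lambda>u. Q (\<Psi> u) (\<Psi> b) (\<Psi> c))"
    by (rule linear_on_comp[OF \<Psi>, of _ _ "\<lambda>u. Q u (\<Psi> b) (\<Psi> c)"])
      (use Q b c mem in \<open>simp add: D\<close>)
  have "\<Psi> (P (fps_const x) b c) = Q (\<Psi> (fps_const x)) (\<Psi> b) (\<Psi> c)" if x: "x \<in> L" for x
  proof (rule bilinear_on_fps_eqI[OF _ _ \<Psi> _ b c])
    show "bilinear_on (fps_scale scale) (fps_over L) (P (fps_const x))"
      using P fps_over_const[OF x] by (simp add: D bilinear_on_def)
    show "bilinear_on (fps_scale scale) (fps_over L) (Q (\<Psi> (fps_const x)))"
      using Q mem[OF fps_over_const[OF x]] by (simp add: D bilinear_on_def)
  qed (use x const in auto)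
  then show ?thesis
    by (intro fps_linear_eqI[OF P1 Q1 _ a])
qed

definition coeffwise :: "('a \<Rightarrow> 'a) \<Rightarrow> 'a fps \<Rightarrow> 'a fps" where
  "coeffwise f a = Abs_fps (\<lambda>n. f (a $ n))"

text \<open>
  This is \<open>\<Sum>i. t\<^sup>i T\<^sub>i\<close>. In each single argument, the maps induced on power series by families of
  multilinear maps arise from coefficientwise maps by iterating such sums, so that their
  linearity follows from the two lemmas below.
\<close>

definition power_sum :: "(nat \<Rightarrow> 'a fps \<Rightarrow> 'a fps) \<Rightarrow> 'a fps \<Rightarrow> 'a fps" where
  "power_sum T a = Abs_fps (\<lambda>n. \<Sum>i\<le>n. T i a $ (n - i))"

lemma coeffwise_linear:
  assumes "linear_on scale L scale L f"
  shows "fps_linear (coeffwise f)"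
  unfolding linear_on_def
proof (intro conjI ballI allI funcsetI)
  fix a assume a: "a \<in> fps_over L"
  show "coeffwise f a \<in> fps_over L"
    using assms a by (auto simp: linear_on_def fps_over_def coeffwise_def)
  show "coeffwise f (a + b) = coeffwise f a + coeffwise f b" if "b \<in> fps_over L" for b
    using assms a that by (intro fps_ext) (auto simp: linear_on_def fps_over_def coeffwise_def)
  fix c
  show "coeffwise f (fps_scale scale c a) = fps_scale scale c (coeffwise f a)"
  proof (rule fps_ext)
    fix n
    have aL: "a $ m \<in> L" for m using a by (simp add: fps_over_def)
    have "coeffwise f (fps_scale scale c a) $ n = (\<Sum>i\<le>n. f (scale (c $ i) (a $ (n - i))))"
      by (simp add: coeffwise_def fps_scale_nth linear_on_sum[OF assms] L_closed(4) aL)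
    also have "\<dots> = fps_scale scale c (coeffwise f a) $ n"
      using assms aL by (simp add: coeffwise_def fps_scale_nth linear_on_def)
    finally show "coeffwise f (fps_scale scale c a) $ n = fps_scale scale c (coeffwise f a) $ n" .
  qed
qed

lemma power_sum_linear:
  assumes T: "\<And>i. fps_linear (T i)"
  shows "fps_linear (power_sum T)"
  unfolding linear_on_def
proof (intro conjI ballI allI funcsetI)
  fix a assume a: "a \<in> fps_over L"
  have "T i a \<in> fps_over L" for i using T[of i] a by (auto simp: linear_on_def)
  then show "power_sum T a \<in> fps_over L"
    by (auto simp: fps_over_def power_sum_def intro!: L_closed(5))
  show "power_sum T (a + b) = power_sum T a + power_sum T b" if b: "b \<in> fps_over L" for b
  proof -
    have "T i (a + b) = T i a + T i b" for i using T[of i] a b by (simp add: linear_on_def)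
    then show ?thesis by (intro fps_ext) (simp add: power_sum_def sum.distrib)
  qed
  fix c
  have Tc: "T i (fps_scale scale c a) = fps_scale scale c (T i a)" for i
    using T[of i] a by (simp add: linear_on_def)
  show "power_sum T (fps_scale scale c a) = fps_scale scale c (power_sum T a)"
  proof (rule fps_ext)
    fix n
    have "power_sum T (fps_scale scale c a) $ n =
        (\<Sum>i\<le>n. \<Sum>j\<le>n - i. scale (c $ j) (T i a $ (n - i - j)))"
      by (simp add: power_sum_def Tc fps_scale_nth)
    also have "\<dots> = (\<Sum>j\<le>n. \<Sum>i\<le>n - j. scale (c $ j) (T i a $ (n - i - j)))"
      by (rule sum_triangle_swap)
    also have "\<dots> = fps_scale scale c (power_sum T a) $ n"
      by (simp add: power_sum_def fps_scale_nth scale_sum_right add.commute)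
    finally show "power_sum T (fps_scale scale c a) $ n = fps_scale scale c (power_sum T a) $ n" .
  qed
qed

lemma fps_map1_linear:
  assumes "\<And>i. linear_on scale L scale L (\<phi> i)"
  shows "fps_linear (fps_map1 \<phi>)"
proof -
  have "fps_map1 \<phi> = power_sum (\<lambda>i. coeffwise (\<phi> i))"
    by (intro ext) (simp add: fps_map1_def power_sum_def coeffwise_def)
  then show ?thesis using assms by (simp add: power_sum_linear coeffwise_linear)
qed

lemma fps_map2_bilinear:
  assumes F: "\<And>i. bilinear_on scale L (F i)"
  shows "bilinear_on (fps_scale scale) (fps_over L) (fps_map2 F)"
  unfolding bilinear_on_def
proof (intro conjI ballI)
  fix a assume a: "a \<in> fps_over L"
  have "fps_map2 F a = power_sum (\<lambda>i. power_sum (\<lambda>p. coeffwise (F i (a $ p))))"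
    by (intro ext) (simp add: fps_map2_def power_sum_def coeffwise_def)
  moreover have "linear_on scale L scale L (F i (a $ p))" for i p
    using F[of i] a by (simp add: bilinear_on_def fps_over_def)
  ultimately show "fps_linear (\<lambda>b. fps_map2 F a b)"
    by (simp add: power_sum_linear coeffwise_linear)
  have "(\<lambda>b. fps_map2 F b a) = power_sum (\<lambda>i. power_sum (\<lambda>p. coeffwise (\<lambda>x. F i x (a $ p))))"
  proof (intro ext fps_ext)
    fix b n
    have flip: "(\<Sum>p\<le>m. F i (b $ p) (a $ (m - p))) = (\<Sum>p\<le>m. F i (b $ (m - p)) (a $ p))" for i m
      using sum.nat_diff_reindex[of "\<lambda>p. F i (b $ p) (a $ (m - p))" "Suc m"]
      by (simp add: lessThan_Suc_atMost)
    show "fps_map2 F b a $ n =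
        power_sum (\<lambda>i. power_sum (\<lambda>p. coeffwise (\<lambda>x. F i x (a $ p)))) b $ n"
      by (simp add: fps_map2_def power_sum_def coeffwise_def flip del: diff_diff_left)
  qed
  moreover have "linear_on scale L scale L (\<lambda>x. F i x (a $ p))" for i p
    using F[of i] a by (simp add: bilinear_on_def fps_over_def)
  ultimately show "fps_linear (\<lambda>b. fps_map2 F b a)"
    by (simp add: power_sum_linear coeffwise_linear)
qed

lemma bilinear_on_constant_family:
  assumes "bilinear_on scale L br"
  shows "bilinear_on scale L (if i = (0::nat) then br else (\<lambda>_ _. 0))"
  using assms L_closed(1) by (simp add: bilinear_on_def linear_on_def)

lemma trilinear_on_constant_family:
  assumes "trilinear_on scale L tr"
  shows "trilinear_on scale L (if i = (0::nat) then tr else (\<lambda>_ _ _. 0))"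
  using assms L_closed(1) by (simp add: trilinear_on_def linear_on_def)

text \<open>
  Freezing one argument of a trilinear map leaves a bilinear map, so each of the three partial
  maps of \<open>G\<^sub>t\<close> is a double sum \<open>\<Sum>i p. t\<^bsup>i + p\<^esup> T\<^sub>i\<^sub>p\<close>, where \<open>T\<^sub>i\<^sub>p\<close> is the extension to power series of
  \<open>G\<^sub>i\<close> with the \<open>p\<close>-th coefficient of a frozen argument inserted. Each \<open>T\<^sub>i\<^sub>p\<close> is
  bilinear by \<open>fps_map2_bilinear\<close>.
\<close>

lemma fps_map3_trilinear:
  assumes G: "\<And>i. trilinear_on scale L (G i)"
  shows "trilinear_on (fps_scale scale) (fps_over L) (fps_map3 G)"
proof -
  let ?C = "\<lambda>g. fps_map2 (\<lambda>j. if j = (0::nat) then g else (\<lambda>_ _. 0::'a))"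
  have C: "?C g y z $ n = (\<Sum>p\<le>n. g (y $ p) (z $ (n - p)))" for g y z n
  proof -
    have "?C g y z $ n = (\<Sum>j\<le>n. if j = 0 then \<Sum>p\<le>n. g (y $ p) (z $ (n - p)) else 0)"
      unfolding fps_map2_def fps_nth_Abs_fps by (intro sum.cong) auto
    then show ?thesis by simp
  qed
  have C_linear: "fps_linear (\<lambda>y. ?C g y z)" "fps_linear (\<lambda>y. ?C g z y)"
    if "bilinear_on scale L g" "z \<in> fps_over L" for g z
    using fps_map2_bilinear[OF bilinear_on_constant_family, OF that(1)] that(2)
    by (simp_all add: bilinear_on_def)
  have arg1: "fps_map3 G a b c =
      power_sum (\<lambda>i. power_sum (\<lambda>p. \<lambda>a. ?C (\<lambda>x z. G i x (b $ p) z) a c)) a" for a b c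
  proof (rule fps_ext)
    fix n
    have "(\<Sum>p\<le>m. \<Sum>q\<le>m - p. G i (a $ p) (b $ q) (c $ (m - p - q))) =
        (\<Sum>q\<le>m. \<Sum>p\<le>m - q. G i (a $ p) (b $ q) (c $ (m - q - p)))" for i m
      using sum_triangle_swap[of "\<lambda>p q. G i (a $ p) (b $ q) (c $ (m - p - q))" m]
      by (simp add: add.commute)
    then show "fps_map3 G a b c $ n =
        power_sum (\<lambda>i. power_sum (\<lambda>p. \<lambda>a. ?C (\<lambda>x z. G i x (b $ p) z) a c)) a $ n"
      by (simp add: fps_map3_def power_sum_def C del: diff_diff_left)
  qed
  have arg2: "fps_map3 G a b c = power_sum (\<lambda>i. power_sum (\<lambda>p. \<lambda>b. ?C (G i (a $ p)) b c)) b"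
    and arg3: "fps_map3 G a b c = power_sum (\<lambda>i. power_sum (\<lambda>p. \<lambda>c. ?C (G i (a $ p)) b c)) c"
    for a b c
    by (rule fps_ext, simp add: fps_map3_def power_sum_def C add.assoc)+
  have G': "bilinear_on scale L (G i x)" "bilinear_on scale L (\<lambda>y z. G i y x z)"
    if "x \<in> L" for i x
    using G[of i] that by (auto simp: trilinear_on_def bilinear_on_def)
  show ?thesis
    unfolding trilinear_on_def
  proof (intro conjI ballI)
    fix a b assume a: "a \<in> fps_over L" and b: "b \<in> fps_over L"
    then have ab: "a $ p \<in> L" "b $ p \<in> L" for p by (auto simp: fps_over_def)
    show "fps_linear (\<lambda>x. fps_map3 G x a b)"
      unfolding arg1 using ab b by (intro power_sum_linear C_linear G')
    show "fps_linear (\<lambda>x. fps_map3 G a x b)"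
      unfolding arg2 using ab b by (intro power_sum_linear C_linear G')
    show "fps_linear (\<lambda>x. fps_map3 G a b x)"
      unfolding arg3 using ab b by (intro power_sum_linear C_linear G')
  qed
qed

lemma fps_map1_const:
  assumes "\<And>i. linear_on scale L scale L (\<phi> i)"
  shows "fps_map1 \<phi> (fps_const x) = Abs_fps (\<lambda>n. \<phi> n x)"
proof (rule fps_ext)
  fix n
  have "fps_map1 \<phi> (fps_const x) $ n = (\<Sum>i\<le>n. if i = n then \<phi> n x else 0)"
    unfolding fps_map1_def fps_nth_Abs_fps
    using linear_on_zero[OF assms L_closed(1)] by (intro sum.cong) auto
  then show "fps_map1 \<phi> (fps_const x) $ n = Abs_fps (\<lambda>n. \<phi> n x) $ n" by simp
qed

lemma fps_map2_constant_family_const: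
  assumes "bilinear_on scale L br" "x \<in> L" "y \<in> L"
  shows "fps_map2 (\<lambda>i. if i = 0 then br else (\<lambda>_ _. 0)) (fps_const x) (fps_const y) =
    fps_const (br x y)"
proof (rule fps_ext)
  fix n
  have z: "br 0 y = 0" "br x 0 = 0" "br 0 0 = 0"
    using assms L_closed(1) linear_on_zero[of scale L "\<lambda>u. br u _"] linear_on_zero[of scale L "br _"]
    by (auto simp: bilinear_on_def)
  show "fps_map2 (\<lambda>i. if i = 0 then br else (\<lambda>_ _. 0)) (fps_const x) (fps_const y) $ n =
    fps_const (br x y) $ n"
  proof (cases "n = 0")
    case True
    then show ?thesis by (simp add: fps_map2_def)
  next
    case False
    then show ?thesis using z by (auto simp: fps_map2_def intro!: sum.neutral)
  qed
qed

lemma fps_map3_constant_family_const: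
  assumes "trilinear_on scale L tr" "x \<in> L" "y \<in> L" "z \<in> L"
  shows "fps_map3 (\<lambda>i. if i = 0 then tr else (\<lambda>_ _ _. 0)) (fps_const x) (fps_const y) (fps_const z) =
    fps_const (tr x y z)"
proof (rule fps_ext)
  fix n
  have "tr 0 u v = 0" "tr u 0 v = 0" "tr u v 0 = 0" if "u \<in> L" "v \<in> L" for u v
    using assms(1) that L_closed(1) linear_on_zero[of scale L "\<lambda>w. tr w u v"]
      linear_on_zero[of scale L "\<lambda>w. tr u w v"] linear_on_zero[of scale L "tr u v"]
    by (auto simp: trilinear_on_def)
  then show "fps_map3 (\<lambda>i. if i = 0 then tr else (\<lambda>_ _ _. 0))
      (fps_const x) (fps_const y) (fps_const z) $ n = fps_const (tr x y z) $ n"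
    using assms(2-4) L_closed(1)
    by (cases "n = 0") (auto simp: fps_map3_def intro!: sum.neutral)
qed

section \<open>Inverting a perturbation of the identity\<close>

text \<open>
  The recursion solves \<open>(\<Sum>i. \<phi>\<^sub>i t\<^sup>i) (\<Sum>j. \<psi>\<^sub>j t\<^sup>j) = id\<close> for \<open>\<phi>\<^sub>n\<close>, assuming \<open>\<psi>\<^sub>0 = id\<close>: the coefficient of
  \<open>t\<^sup>n\<close> on the left is \<open>\<phi>\<^sub>n\<close> plus the terms \<open>\<phi>\<^sub>i \<psi>\<^bsub>n - i\<^esub>\<close> with \<open>i < n\<close>.
\<close>

fun inverse_family :: "(nat \<Rightarrow> 'a \<Rightarrow> 'a) \<Rightarrow> nat \<Rightarrow> 'a \<Rightarrow> 'a" where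
  "inverse_family \<psi> n x =
     (if n = 0 then x else - (\<Sum>i<n. inverse_family \<psi> i (\<psi> (n - i) x)))"

declare inverse_family.simps [simp del]

lemma inverse_family_0: "inverse_family \<psi> 0 x = x"
  by (simp add: inverse_family.simps)

lemma inverse_family_linear:
  assumes \<psi>: "\<And>i. linear_on scale L scale L (\<psi> i)"
  shows "linear_on scale L scale L (inverse_family \<psi> n)"
proof (induction n rule: less_induct)
  case (less n)
  show ?case
  proof (cases "n = 0")
    case True
    then show ?thesis by (simp add: linear_on_def inverse_family_0)
  next
    case False
    have eq: "inverse_family \<psi> n x = - (\<Sum>i<n. inverse_family \<psi> i (\<psi> (n - i) x))" for x
      using False by (subst inverse_family.simps) simp
    have lin: "linear_on scale L scale L (\<lambda>x. inverse_family \<psi> i (\<psi> (n - i) x))" if "i < n" for i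
      by (rule linear_on_comp[OF \<psi> less.IH[OF that]])
    show ?thesis
      unfolding linear_on_def eq
    proof (intro conjI ballI allI funcsetI)
      fix x assume x: "x \<in> L"
      show "- (\<Sum>i<n. inverse_family \<psi> i (\<psi> (n - i) x)) \<in> L"
        using lin x by (intro L_closed) (auto simp: linear_on_def Pi_iff)
      show "- (\<Sum>i<n. inverse_family \<psi> i (\<psi> (n - i) (x + y))) =
          - (\<Sum>i<n. inverse_family \<psi> i (\<psi> (n - i) x)) +
          - (\<Sum>i<n. inverse_family \<psi> i (\<psi> (n - i) y))" if "y \<in> L" for y
        using lin x that by (simp add: linear_on_def sum.distrib)
      show "- (\<Sum>i<n. inverse_family \<psi> i (\<psi> (n - i) (scale c x))) =
          scale c (- (\<Sum>i<n. inverse_family \<psi> i (\<psi> (n - i) x)))" for c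
        using lin x by (simp add: linear_on_def scale_sum_right)
    qed
  qed
qed

lemma inverse_family_left_inverse:
  assumes \<psi>: "\<And>i. linear_on scale L scale L (\<psi> i)"
    and \<psi>0: "\<And>x. x \<in> L \<Longrightarrow> \<psi> 0 x = x"
    and a: "a \<in> fps_over L"
  shows "fps_map1 (inverse_family \<psi>) (fps_map1 \<psi> a) = a"
proof (rule fps_linear_eqI[OF _ _ _ a])
  show "fps_linear (\<lambda>a. fps_map1 (inverse_family \<psi>) (fps_map1 \<psi> a))"
    by (rule linear_on_comp[OF fps_map1_linear fps_map1_linear])
      (auto intro: \<psi> inverse_family_linear)
  show "fps_linear (\<lambda>a. a)" by (simp add: linear_on_def)
  fix x assume x: "x \<in> L"
  show "fps_map1 (inverse_family \<psi>) (fps_map1 \<psi> (fps_const x)) = fps_const x"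
  proof (rule fps_ext)
    fix n
    have "fps_map1 (inverse_family \<psi>) (fps_map1 \<psi> (fps_const x)) $ n =
        (\<Sum>i\<le>n. inverse_family \<psi> i (\<psi> (n - i) x))"
      unfolding fps_map1_const[of \<psi>, OF \<psi>] by (simp add: fps_map1_def)
    also have "\<dots> = (\<Sum>i<n. inverse_family \<psi> i (\<psi> (n - i) x)) + inverse_family \<psi> n x"
      using \<psi>0[OF x] by (simp flip: lessThan_Suc_atMost)
    also have "\<dots> = fps_const x $ n"
      by (subst (2) inverse_family.simps) simp
    finally show "fps_map1 (inverse_family \<psi>) (fps_map1 \<psi> (fps_const x)) $ n = fps_const x $ n" .
  qed
qed

text \<open>
  The left inverse \<open>\<Phi>\<close> of \<open>\<Psi>\<close> is itself a perturbation of the identity, so it has a left inverse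
  \<open>X\<close>; then \<open>X = X \<Phi> \<Psi> = \<Psi>\<close>, and \<open>\<Psi>\<close> is inverse to \<open>\<Phi>\<close> on both sides.
\<close>

lemma inverse_family_right_inverse:
  assumes \<psi>: "\<And>i. linear_on scale L scale L (\<psi> i)"
    and \<psi>0: "\<And>x. x \<in> L \<Longrightarrow> \<psi> 0 x = x"
    and a: "a \<in> fps_over L"
  shows "fps_map1 \<psi> (fps_map1 (inverse_family \<psi>) a) = a"
proof -
  let ?\<Psi> = "fps_map1 \<psi>" and ?\<Phi> = "fps_map1 (inverse_family \<psi>)"
    and ?X = "fps_map1 (inverse_family (inverse_family \<psi>))"
  note \<phi> = inverse_family_linear[of \<psi>, OF \<psi>]
  have left: "?X (?\<Phi> b) = b" if "b \<in> fps_over L" for b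
    by (rule inverse_family_left_inverse) (auto intro: \<phi> inverse_family_0 that)
  have mem: "?\<Phi> a \<in> fps_over L" and mem': "?\<Psi> (?\<Phi> a) \<in> fps_over L"
    using fps_map1_linear[of \<psi>, OF \<psi>] fps_map1_linear[of "inverse_family \<psi>", OF \<phi>] a
    by (auto simp: linear_on_def)
  have "?\<Psi> (?\<Phi> a) = ?X (?\<Phi> (?\<Psi> (?\<Phi> a)))" by (simp add: left[OF mem'])
  also have "?\<Phi> (?\<Psi> (?\<Phi> a)) = ?\<Phi> a" by (rule inverse_family_left_inverse[of \<psi>, OF \<psi> \<psi>0 mem])
  also have "?X (?\<Phi> a) = a" by (rule left[OF a])
  finally show ?thesis .
qed

end

section \<open>Rigidity from the universal property\<close>

text \<open>
  A deformation is an algebra over \<open>K[[t]]\<close>, whereas freeness of \<open>L\<close> speaks of algebras over \<open>K\<close>;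
  the instance relevant here is the inclusion of \<open>K\<close> into \<open>K[[t]]\<close> as \<open>r\<close>.
\<close>

lemma ly_algebra_restrict_scalars:
  fixes r :: "'k::comm_ring_1 \<Rightarrow> 'l::comm_ring_1"
  assumes "ly_algebra scale M br tr"
    and r: "r 1 = 1" "\<And>c d. r (c + d) = r c + r d" "\<And>c d. r (c * d) = r c * r d"
  shows "ly_algebra (\<lambda>c. scale (r c)) M br tr"
proof -
  interpret ly_algebra scale M br tr by fact
  interpret k: module "\<lambda>c. scale (r c)"
    by standard (simp_all add: r scale_right_distrib scale_left_distrib)
  show ?thesis
  proof
    show "k.subspace M" by (rule k.subspaceI) (auto intro: closed)
    show "bilinear_on (\<lambda>c. scale (r c)) M br"
      using bilinear by (simp add: bilinear_on_def linear_on_def)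
    show "trilinear_on (\<lambda>c. scale (r c)) M tr"
      using trilinear by (simp add: trilinear_on_def linear_on_def)
  qed (fact LY1 LY2 LY3 LY4 LY5 LY6)+
qed

lemma is_free_ly_extension:
  fixes scale' :: "'k::comm_ring_1 \<Rightarrow> 'c::ab_group_add \<Rightarrow> 'c"
  assumes "is_free_ly TYPE('c) scale L br tr B i"
    and "ly_algebra scale' M br' tr'" "f \<in> B \<rightarrow> M"
  shows "\<exists>h. ly_hom scale L br tr scale' M br' tr' h \<and> (\<forall>b\<in>B. h (i b) = f b) \<and>
    (\<forall>h'. ly_hom scale L br tr scale' M br' tr' h' \<and> (\<forall>b\<in>B. h' (i b) = f b)
       \<longrightarrow> (\<forall>x\<in>L. h' x = h x))"
  using assms unfolding is_free_ly_def by simp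

lemma is_free_ly_hom_eq_id:
  fixes scale :: "'k::comm_ring_1 \<Rightarrow> 'a::ab_group_add \<Rightarrow> 'a"
  assumes free: "is_free_ly TYPE('a) scale L br tr B i"
    and h: "ly_hom scale L br tr scale L br tr h" "\<And>b. b \<in> B \<Longrightarrow> h (i b) = i b"
    and x: "x \<in> L"
  shows "h x = x"
proof -
  have "ly_algebra scale L br tr \<and> i \<in> B \<rightarrow> L" using free by (simp add: is_free_ly_def)
  then obtain g where g: "\<forall>h'. ly_hom scale L br tr scale L br tr h' \<and>
      (\<forall>b\<in>B. h' (i b) = i b) \<longrightarrow> (\<forall>x\<in>L. h' x = g x)"
    using is_free_ly_extension[OF free, of scale L br tr i] by blast
  have "ly_hom scale L br tr scale L br tr (\<lambda>x. x)"
    by (simp add: ly_hom_def linear_on_def)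
  then show ?thesis using spec[OF g, of "\<lambda>x. x"] spec[OF g, of h] h x by simp
qed

text \<open>
  The universal property is used twice: against the deformed algebra, which lives on \<open>'a fps\<close>, for
  the existence of \<open>h\<close>, and against \<open>L\<close> itself for \<open>\<psi>\<^sub>0 = id\<close>.
\<close>

theorem free_ly_rigid:
  fixes scale :: "'k::comm_ring_1 \<Rightarrow> 'a::ab_group_add \<Rightarrow> 'a"
  assumes free: "is_free_ly TYPE('a) scale L br tr B i"
    and free_fps: "is_free_ly TYPE('a fps) scale L br tr B i"
  shows "ly_rigid scale L br tr"
  unfolding ly_rigid_def
proof (intro allI impI)
  fix F G
  assume "formal_deformation scale L br tr F G"
  then have F0: "\<And>x y. \<lbrakk>x \<in> L; y \<in> L\<rbrakk> \<Longrightarrow> F 0 x y = br x y"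
    and G0: "\<And>x y z. \<lbrakk>x \<in> L; y \<in> L; z \<in> L\<rbrakk> \<Longrightarrow> G 0 x y z = tr x y z"
    and deformed: "ly_algebra (fps_scale scale) (fps_over L) (fps_map2 F) (fps_map3 G)"
    by (auto simp: formal_deformation_def)
  interpret L: ly_algebra scale L br tr using free by (simp add: is_free_ly_def)
  interpret coefficient_module scale L by standard (rule L.submodule)
  interpret deformed: ly_algebra "fps_scale scale" "fps_over L" "fps_map2 F" "fps_map3 G"
    by (rule deformed)
  let ?F' = "\<lambda>i. if i = 0 then br else (\<lambda>_ _. 0)" and ?G' = "\<lambda>i. if i = 0 then tr else (\<lambda>_ _ _. 0)"
  let ?scale = "\<lambda>c. fps_scale scale (fps_const c)"
  have i: "i \<in> B \<rightarrow> L" using free by (simp add: is_free_ly_def)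

  have "ly_algebra ?scale (fps_over L) (fps_map2 F) (fps_map3 G)"
    by (rule ly_algebra_restrict_scalars[OF deformed]) simp_all
  moreover have "(\<lambda>b. fps_const (i b)) \<in> B \<rightarrow> fps_over L"
    using i by (auto intro: fps_over_const)
  ultimately obtain h where
    h: "ly_hom scale L br tr ?scale (fps_over L) (fps_map2 F) (fps_map3 G) h"
    and h_gen: "\<forall>b\<in>B. h (i b) = fps_const (i b)"
    using is_free_ly_extension[OF free_fps] by blast
  have h_mem: "h x \<in> fps_over L" if "x \<in> L" for x
    using h that by (auto simp: ly_hom_def linear_on_def)

  define \<psi> where "\<psi> n x = h x $ n" for n x
  have \<psi>: "linear_on scale L scale L (\<psi> n)" for n
    using h h_mem by (simp add: ly_hom_def linear_on_def \<psi>_def fps_scale_const_nth fps_over_def)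
  have \<psi>0: "\<psi> 0 x = x" if "x \<in> L" for x
  proof (rule is_free_ly_hom_eq_id[OF free _ _ that])
    have "h x $ 0 \<in> L" if "x \<in> L" for x using h_mem[OF that] by (simp add: fps_over_def)
    then show "ly_hom scale L br tr scale L br tr (\<psi> 0)"
      using h \<psi>[of 0] F0 G0
      by (simp add: ly_hom_def \<psi>_def fps_map2_def fps_map3_def)
  qed (use h_gen in \<open>simp add: \<psi>_def\<close>)

  let ?\<Psi> = "fps_map1 \<psi>" and ?\<Phi> = "fps_map1 (inverse_family \<psi>)"
  note \<phi> = inverse_family_linear[of \<psi>, OF \<psi>]
  have \<Psi>_const: "?\<Psi> (fps_const x) = h x" for x
    by (simp add: fps_map1_const[of \<psi>, OF \<psi>] \<psi>_def fps_nth_inverse)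
  note left = inverse_family_left_inverse[of \<psi>, OF \<psi> \<psi>0]
    and right = inverse_family_right_inverse[of \<psi>, OF \<psi> \<psi>0]
  have \<Psi>_mem: "?\<Psi> a \<in> fps_over L" and \<Phi>_mem: "?\<Phi> a \<in> fps_over L" if "a \<in> fps_over L" for a
    using fps_map1_linear[of \<psi>, OF \<psi>] fps_map1_linear[of "inverse_family \<psi>", OF \<phi>] that
    by (auto simp: linear_on_def)

  have F'_bilinear: "bilinear_on (fps_scale scale) (fps_over L) (fps_map2 ?F')"
    by (intro fps_map2_bilinear bilinear_on_constant_family L.bilinear)
  have G'_trilinear: "trilinear_on (fps_scale scale) (fps_over L) (fps_map3 ?G')"
    by (intro fps_map3_trilinear trilinear_on_constant_family L.trilinear)
  have \<Psi>_br: "?\<Psi> (fps_map2 ?F' a b) = fps_map2 F (?\<Psi> a) (?\<Psi> b)"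
    if "a \<in> fps_over L" "b \<in> fps_over L" for a b
  proof (rule bilinear_on_fps_eqI[OF F'_bilinear deformed.bilinear fps_map1_linear[of \<psi>, OF \<psi>] _ that])
    fix x y assume "x \<in> L" "y \<in> L"
    then show "?\<Psi> (fps_map2 ?F' (fps_const x) (fps_const y)) =
        fps_map2 F (?\<Psi> (fps_const x)) (?\<Psi> (fps_const y))"
      using h by (simp add: fps_map2_constant_family_const[OF L.bilinear] \<Psi>_const ly_hom_def)
  qed
  have \<Psi>_tr: "?\<Psi> (fps_map3 ?G' a b c) = fps_map3 G (?\<Psi> a) (?\<Psi> b) (?\<Psi> c)"
    if "a \<in> fps_over L" "b \<in> fps_over L" "c \<in> fps_over L" for a b c
  proof (rule trilinear_on_fps_eqI[OF G'_trilinear deformed.trilinear fps_map1_linear[of \<psi>, OF \<psi>] _ that])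
    fix x y z assume "x \<in> L" "y \<in> L" "z \<in> L"
    then show "?\<Psi> (fps_map3 ?G' (fps_const x) (fps_const y) (fps_const z)) =
        fps_map3 G (?\<Psi> (fps_const x)) (?\<Psi> (fps_const y)) (?\<Psi> (fps_const z))"
      using h by (simp add: fps_map3_constant_family_const[OF L.trilinear] \<Psi>_const ly_hom_def)
  qed

  have F'_mem: "fps_map2 ?F' a b \<in> fps_over L" if "a \<in> fps_over L" "b \<in> fps_over L" for a b
    by (rule linear_on_mem[of "fps_scale scale" "fps_over L" "fps_scale scale" "fps_over L"])
      (use F'_bilinear that in \<open>simp_all only: bilinear_on_def\<close>)
  have G'_mem: "fps_map3 ?G' a b c \<in> fps_over L"
    if "a \<in> fps_over L" "b \<in> fps_over L" "c \<in> fps_over L" for a b c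
    by (rule linear_on_mem[of "fps_scale scale" "fps_over L" "fps_scale scale" "fps_over L"])
      (use G'_trilinear that in \<open>simp_all only: trilinear_on_def\<close>)
  have \<Phi>_br: "?\<Phi> (fps_map2 F a b) = fps_map2 ?F' (?\<Phi> a) (?\<Phi> b)"
    if "a \<in> fps_over L" "b \<in> fps_over L" for a b
  proof -
    have "fps_map2 F a b = ?\<Psi> (fps_map2 ?F' (?\<Phi> a) (?\<Phi> b))"
      by (simp only: \<Psi>_br \<Phi>_mem right that)
    then show ?thesis by (simp only: left F'_mem \<Phi>_mem that)
  qed
  have \<Phi>_tr: "?\<Phi> (fps_map3 G a b c) = fps_map3 ?G' (?\<Phi> a) (?\<Phi> b) (?\<Phi> c)"
    if "a \<in> fps_over L" "b \<in> fps_over L" "c \<in> fps_over L" for a b c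
  proof -
    have "fps_map3 G a b c = ?\<Psi> (fps_map3 ?G' (?\<Phi> a) (?\<Phi> b) (?\<Phi> c))"
      by (simp only: \<Psi>_tr \<Phi>_mem right that)
    then show ?thesis by (simp only: left G'_mem \<Phi>_mem that)
  qed
  have "bij_betw ?\<Phi> (fps_over L) (fps_over L)"
    by (rule bij_betw_byWitness[where f' = ?\<Psi>]) (use left right \<Psi>_mem \<Phi>_mem in auto)
  then show "trivial_deformation scale L br tr F G"
    unfolding trivial_deformation_def equivalent_deformations_def
    using \<phi> inverse_family_0 fps_map1_linear[of "inverse_family \<psi>", OF \<phi>] \<Phi>_br \<Phi>_tr fps_over_const
    by (intro exI[of _ "inverse_family \<psi>"] conjI allI ballI) simp_all
qed

theorem theorem6p4:
  fixes scaleV :: "'k::{alg_closed_field, field_char_0} \<Rightarrow> 'v::ab_group_add \<Rightarrow> 'v"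
    and B :: "'v set"
  assumes "finite_dimensional_vector_space scaleV B"
  shows "ly_rigid (free_scale :: 'k \<Rightarrow> ('v, 'k) free_ly \<Rightarrow> ('v, 'k) free_ly)
           (free_ly_over B) free_br free_tr"
  by (rule free_ly_rigid[OF free_ly_universal free_ly_universal])

end
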